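(* Let $d\ge 1$, let $p_1=2,p_2=3,\dots,p_d$ be the first $d$ primes, and let $\xi^*:=\tfrac{1}{\pi}\left(\sqrt{p_1},\sqrt{p_2},\dots,\sqrt{p_d}\right)\in\mathbb{R}^d$. Then: (1) For any two finite sets $A,B\subset\mathbb{Z}^d$: $\sigma_A(\xi^* )=\sigma_B(\xi^* )$ if and only if $A=B$. (2) For any two integer polytopes $\mathcal{P},\mathcal{Q}\subset\mathbb{R}^d$: $\sigma_{\mathcal{P}}(\xi^* )=\sigma_{\mathcal{Q}}(\xi^* )$ if and only if $\mathcal{P}=\mathcal{Q}$. (3) For any two rational polytopes $\mathcal{P},\mathcal{Q}\subset\mathbb{R}^d$ and any positive integer $k$ such that $k\mathcal{P}$ and $k\mathcal{Q}$ are both integer polytopes: $\sigma_{k\mathcal{P}}(\xi^* )=\sigma_{k\mathcal{Q}}(\xi^* )$ if and only if $\mathcal{P}=\mathcal{Q}$.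
   Context: Polytopes are convex by definition (convex hulls of finitely many points, of any dimension). A polytope is an integer (resp. rational) polytope if all coordinates of all its vertices are integers (resp. rationals). For a finite set $S\subset\mathbb{Z}^d$, its integer point transform is $\sigma_S(\xi):=\sum_{n\in S}e^{2\pi i\langle n,\xi\rangle}$ for $\xi\in\mathbb{R}^d$; for a polytope $\mathcal{P}$, $\sigma_{\mathcal{P}}:=\sigma_{\mathcal{P}\cap\mathbb{Z}^d}$. *)

theory Defs
  imports "HOL-Analysis.Analysis" "HOL-Computational_Algebra.Primes" "HOL-Library.Infinite_Set"
begin

text \<open>
  \<open>\<int>\<^sup>d\<close> is taken as a subset of \<open>\<real>\<^sup>d\<close>, so that intersections with polytopes and
  inner products with \<open>\<xi>\<close> need no coercion.
\<close>

definition int_lattice :: "(real ^ 'n::finite) set" where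
  "int_lattice = {x. \<forall>i. x $ i \<in> \<int>}"

text \<open>Only meaningful for finite \<open>S\<close>: the sum is \<open>0\<close> by convention otherwise.\<close>

definition integer_point_transform :: "(real ^ 'n::finite) set \<Rightarrow> real ^ 'n \<Rightarrow> complex" where
  "integer_point_transform S \<xi> =
     (\<Sum>n\<in>S. exp (2 * complex_of_real pi * \<i> * complex_of_real (n \<bullet> \<xi>)))"

text \<open>For a polytope (a bounded set), the intersection with the lattice is finite.\<close>

definition polytope_transform :: "(real ^ 'n::finite) set \<Rightarrow> real ^ 'n \<Rightarrow> complex" where
  "polytope_transform P = integer_point_transform (P \<inter> int_lattice)"

text \<open>The vertices of a polytope are its extreme points. The empty set counts as a polytope.\<close>

definition integer_polytope :: "(real ^ 'n::finite) set \<Rightarrow> bool" where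
  "integer_polytope P \<longleftrightarrow> polytope P \<and> (\<forall>v. v extreme_point_of P \<longrightarrow> (\<forall>i. v $ i \<in> \<int>))"

definition rational_polytope :: "(real ^ 'n::finite) set \<Rightarrow> bool" where
  "rational_polytope P \<longleftrightarrow> polytope P \<and> (\<forall>v. v extreme_point_of P \<longrightarrow> (\<forall>i. v $ i \<in> \<rat>))"

text \<open>Indexed from 0: \<open>nth_prime 0 = 2\<close>, \<open>nth_prime 1 = 3\<close>, and so on.\<close>

definition nth_prime :: "nat \<Rightarrow> nat" where
  "nth_prime = enumerate {p. prime p}"

text \<open>
  The finite index type \<open>'n\<close> carries no order, so the numbering \<open>e\<close> of the coordinates, meant
  to be a bijection from \<open>'n\<close> onto \<open>{..<CARD('n)}\<close>, is a parameter.
\<close>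

definition xi_star :: "('n::finite \<Rightarrow> nat) \<Rightarrow> real ^ 'n" where
  "xi_star e = (1 / pi) *\<^sub>R (\<chi> i. sqrt (real (nth_prime (e i))))"

end

theory Submission
  imports Defs "HOL-Computational_Algebra.Polynomial"
begin

text \<open>
  Since \<open>2\<pi>\<langle>n, \<xi>\<^sup>*\<rangle> = 2 \<Sum> n\<^sub>i \<surd>p\<^sub>i\<close>, the difference of two
  transforms is an integer combination of exponentials of \<open>2\<i> \<Sum> n\<^sub>i \<surd>p\<^sub>i\<close>, so part (1) is
  a case of the Lindemann--Weierstrass theorem, the exponents being distinct because the \<open>\<surd>p\<^sub>i\<close> are
  linearly independent over \<open>\<rat>\<close>. Here the Galois group acts on the exponents by sign changes of the
  coordinates of \<open>n\<close>. Multiplying a vanishing combination by its conjugates makes its coefficients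
  invariant under sign changes, and squaring it then makes the constant coefficient a positive sum of
  squares. Invariance makes all power sums of the exponents, weighted with the coefficients, rational
  integers, and Hermite's argument with the auxiliary polynomial \<open>X\<^sup>p\<^sup>-\<^sup>1 g\<^sup>p\<close> gives a contradiction,
  where \<open>g\<close> is an integer polynomial vanishing at the nonzero exponents but not at 0.
  Parts (2) and (3) follow as an integer polytope is the convex hull of its lattice points.
\<close>

subsection \<open>Square roots of distinct primes\<close>

text \<open>The field generated over the rationals by the square roots of \<open>S\<close>, given
  inductively so that its elements can be treated by induction on their construction.\<close>

inductive_set sqrt_closure :: "nat set \<Rightarrow> real set" for S where
  Rats: "x \<in> \<rat> \<Longrightarrow> x \<in> sqrt_closure S"
| sqrt: "q \<in> S \<Longrightarrow> sqrt (real q) \<in> sqrt_closure S"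
| add: "x \<in> sqrt_closure S \<Longrightarrow> y \<in> sqrt_closure S \<Longrightarrow> x + y \<in> sqrt_closure S"
| mult: "x \<in> sqrt_closure S \<Longrightarrow> y \<in> sqrt_closure S \<Longrightarrow> x * y \<in> sqrt_closure S"
| inverse: "x \<in> sqrt_closure S \<Longrightarrow> inverse x \<in> sqrt_closure S"

lemma sqrt_closure_uminus: "x \<in> sqrt_closure S \<Longrightarrow> - x \<in> sqrt_closure S"
  using sqrt_closure.mult[OF sqrt_closure.Rats[of "-1"], of x S] by simp

lemma sqrt_closure_diff:
  "x \<in> sqrt_closure S \<Longrightarrow> y \<in> sqrt_closure S \<Longrightarrow> x - y \<in> sqrt_closure S"
  using sqrt_closure.add[of x S "- y"] sqrt_closure_uminus[of y S] by simp

lemma sqrt_closure_divide: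
  "x \<in> sqrt_closure S \<Longrightarrow> y \<in> sqrt_closure S \<Longrightarrow> x / y \<in> sqrt_closure S"
  by (simp add: divide_inverse sqrt_closure.mult sqrt_closure.inverse)

lemma sqrt_closure_sum:
  "(\<And>i. i \<in> I \<Longrightarrow> f i \<in> sqrt_closure S) \<Longrightarrow> sum f I \<in> sqrt_closure S"
  by (induction I rule: infinite_finite_induct)
     (auto intro: sqrt_closure.add sqrt_closure.Rats)

lemma sqrt_closure_empty: "sqrt_closure {} = \<rat>"
proof
  show "sqrt_closure {} \<subseteq> \<rat>"
  proof
    fix x assume "x \<in> sqrt_closure {}"
    then show "x \<in> \<rat>" by induction auto
  qed
qed (auto intro: sqrt_closure.Rats)

text \<open>Adjoining one square root gives an extension of degree at most 2. Only inverses need an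
  idea: the conjugate \<open>x - y * sqrt q\<close> rationalizes the denominator.\<close>

lemma sqrt_closure_insertE:
  assumes "z \<in> sqrt_closure (insert q S)"
  obtains x y where "x \<in> sqrt_closure S" "y \<in> sqrt_closure S" "z = x + y * sqrt (real q)"
proof -
  have "\<exists>x\<in>sqrt_closure S. \<exists>y\<in>sqrt_closure S. z = x + y * sqrt (real q)"
    using assms
  proof induction
    case (Rats x)
    then show ?case
      by (intro bexI[of _ x] bexI[of _ 0]) (auto intro: sqrt_closure.Rats)
  next
    case (sqrt p)
    then show ?case
    proof
      assume "p = q"
      then show ?thesis
        by (intro bexI[of _ 0] bexI[of _ 1]) (auto intro: sqrt_closure.Rats)
    next
      assume "p \<in> S"
      then show ?thesis
        by (intro bexI[of _ "sqrt p"] bexI[of _ 0])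
           (auto intro: sqrt_closure.Rats sqrt_closure.sqrt)
    qed
  next
    case (add z1 z2)
    then obtain x1 y1 x2 y2 where *: "x1 \<in> sqrt_closure S" "y1 \<in> sqrt_closure S"
      "z1 = x1 + y1 * sqrt q" "x2 \<in> sqrt_closure S" "y2 \<in> sqrt_closure S" "z2 = x2 + y2 * sqrt q"
      by blast
    then show ?case
      by (intro bexI[of _ "x1 + x2"] bexI[of _ "y1 + y2"])
         (auto intro: sqrt_closure.intros simp: algebra_simps)
  next
    case (mult z1 z2)
    then obtain x1 y1 x2 y2 where *: "x1 \<in> sqrt_closure S" "y1 \<in> sqrt_closure S"
      "z1 = x1 + y1 * sqrt q" "x2 \<in> sqrt_closure S" "y2 \<in> sqrt_closure S" "z2 = x2 + y2 * sqrt q"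
      by blast
    have "z1 * z2 = x1 * x2 + y1 * y2 * (sqrt q * sqrt q) + (x1 * y2 + y1 * x2) * sqrt q"
      unfolding * by algebra
    then have "z1 * z2 = (x1 * x2 + y1 * y2 * real q) + (x1 * y2 + y1 * x2) * sqrt q"
      by simp
    with * show ?case
      by (intro bexI[of _ "x1 * x2 + y1 * y2 * real q"] bexI[of _ "x1 * y2 + y1 * x2"])
         (auto intro!: sqrt_closure.add sqrt_closure.mult intro: sqrt_closure.Rats)
  next
    case (inverse z)
    then obtain x y where *: "x \<in> sqrt_closure S" "y \<in> sqrt_closure S" "z = x + y * sqrt q"
      by blast
    show ?case
    proof (cases "x - y * sqrt q = 0")
      \<comment> \<open>A vanishing conjugate cannot clear the denominator, but then
        \<open>z\<close> already lies in the smaller field: either \<open>y = 0\<close> or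
        \<open>sqrt q = x / y\<close>.\<close>
      case True
      have "z \<in> sqrt_closure S"
      proof (cases "y = 0")
        case False
        with True have "sqrt q = x / y" by (simp add: field_simps)
        then show ?thesis
          using * by (metis sqrt_closure.add sqrt_closure.mult sqrt_closure_divide)
      qed (use * in auto)
      then show ?thesis
        by (intro bexI[of _ "inverse z"] bexI[of _ 0])
           (auto intro: sqrt_closure.Rats sqrt_closure.inverse)
    next
      case False
      define w where "w = x * x - y * y * real q"
      have w: "w \<in> sqrt_closure S"
        unfolding w_def using *
        by (auto intro!: sqrt_closure_diff sqrt_closure.mult intro: sqrt_closure.Rats)
      have "w = x * x - y * y * (sqrt q * sqrt q)" by (simp add: w_def)
      also have "\<dots> = z * (x - y * sqrt q)" unfolding * by algebra
      \<comment> \<open>For \<open>z = 0\<close> also \<open>w = 0\<close>, and the equation holds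
        because inverse and division by zero give 0.\<close>
      finally have "inverse z = (x - y * sqrt q) / w"
        using False by (cases "z = 0") (auto simp: field_simps)
      then have "inverse z = x / w + (- (y / w)) * sqrt q"
        by (simp add: diff_divide_distrib)
      then show ?thesis
        using * w by (intro bexI[of _ "x / w"] bexI[of _ "- (y / w)"])
          (auto intro: sqrt_closure_divide sqrt_closure_uminus)
    qed
  qed
  with that show ?thesis by blast
qed

lemma sqrt_in_Rats_imp_square:
  assumes "sqrt (real a) \<in> \<rat>"
  shows "\<exists>m::nat. a = m ^ 2"
proof -
  have "algebraic_int (sqrt (real a))" by auto
  with assms have "sqrt (real a) \<in> \<int>" using rational_algebraic_int_is_int by blast
  then obtain k where k: "sqrt (real a) = of_int k" by (auto elim: Ints_cases)
  have "real a = (sqrt (real a))\<^sup>2" by simp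
  also have "\<dots> = real (nat \<bar>k\<bar> ^ 2)" unfolding k by simp
  finally show ?thesis by (metis of_nat_eq_iff)
qed

text \<open>Induction on \<open>S\<close> with \<open>a\<close> arbitrary, since the step uses the
  claim for \<open>a\<close>, for \<open>a * q\<close> and for the new prime \<open>q\<close>
  itself.\<close>

lemma sqrt_in_sqrt_closure_imp_square:
  assumes "finite S" "\<And>p. p \<in> S \<Longrightarrow> prime p" "\<And>p. p \<in> S \<Longrightarrow> \<not> p dvd a"
    and "sqrt (real a) \<in> sqrt_closure S"
  shows "\<exists>m::nat. a = m ^ 2"
  using assms
proof (induction S arbitrary: a rule: finite_induct)
  case empty
  then show ?case by (simp add: sqrt_closure_empty sqrt_in_Rats_imp_square)
next
  case (insert q S)
  have q: "prime q" "\<not> q dvd a" using insert.prems by auto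
  have S: "\<And>p. p \<in> S \<Longrightarrow> prime p" "\<And>p. p \<in> S \<Longrightarrow> \<not> p dvd a" using insert.prems by auto
  have Sq: "\<not> p dvd q" if "p \<in> S" for p
    using that S(1)[OF that] q(1) insert.hyps primes_dvd_imp_eq by blast
  obtain x y where xy: "x \<in> sqrt_closure S" "y \<in> sqrt_closure S"
    "sqrt a = x + y * sqrt q"
    using sqrt_closure_insertE[OF insert.prems(3)] by blast
  consider "y = 0" | "x = 0" | "x \<noteq> 0" "y \<noteq> 0" by blast
  then show ?case
  proof cases
    case 1
    then show ?thesis using xy insert.IH[OF S] by simp
  next
    \<comment> \<open>Here \<open>a * q\<close> is a square, which forces \<open>q\<close> to divide
      \<open>a\<close>.\<close>
    case 2
    have "sqrt (real (a * q)) = sqrt a * sqrt q" by (simp add: real_sqrt_mult)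
    also have "\<dots> = y * real q" using 2 xy by simp
    finally have "sqrt (real (a * q)) \<in> sqrt_closure S"
      using xy(2) by (auto intro!: sqrt_closure.mult intro: sqrt_closure.Rats)
    moreover have "\<not> p dvd a * q" if "p \<in> S" for p
      using that S Sq prime_dvd_mult_iff by blast
    ultimately obtain m where m: "a * q = m ^ 2"
      using insert.IH[OF S(1)] by blast
    then have "q dvd m" using q(1) by (metis dvd_triv_right prime_dvd_power)
    then obtain l where "m = q * l" by blast
    with m have "a * q = (q * l ^ 2) * q" by (simp add: power2_eq_square algebra_simps)
    then have "a = q * l ^ 2" using q(1) prime_gt_0_nat by simp
    with q(2) show ?thesis by simp
  next
    \<comment> \<open>Squaring isolates \<open>sqrt q\<close>, because the mixed coefficient
      \<open>2 * x * y\<close> is nonzero; the prime \<open>q\<close> would then be a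
      square.\<close>
    case 3
    have "real a = sqrt a * sqrt a" by simp
    also have "\<dots> = x * x + y * y * (sqrt q * sqrt q) + 2 * x * y * sqrt q"
      unfolding xy by algebra
    finally have "sqrt q = (real a - x * x - y * y * real q) / (2 * x * y)"
      using 3 by (simp add: field_simps)
    also have "\<dots> \<in> sqrt_closure S"
      using xy(1,2)
      by (auto intro!: sqrt_closure_divide sqrt_closure_diff sqrt_closure.mult
          intro: sqrt_closure.Rats)
    finally obtain m where "q = m ^ 2" using insert.IH[OF S(1) Sq] by blast
    then show ?thesis using q(1) prime_power_iff[of m 2] by auto
  qed
qed

text \<open>A nonzero \<open>n j\<close> would allow solving for \<open>sqrt (r j)\<close> in the
  field generated by the other roots, and the prime \<open>r j\<close> would be a square.\<close>

lemma sum_sqrt_primes_eq_0: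
  fixes r :: "'i \<Rightarrow> nat" and n :: "'i \<Rightarrow> int"
  assumes "finite I" "inj_on r I" "\<And>i. i \<in> I \<Longrightarrow> prime (r i)"
    and sum0: "(\<Sum>i\<in>I. of_int (n i) * sqrt (real (r i))) = 0" and "j \<in> I"
  shows "n j = 0"
proof (rule ccontr)
  assume nz: "n j \<noteq> 0"
  define S where "S = r ` (I - {j})"
  have "of_int (n j) * sqrt (r j) = - (\<Sum>i\<in>I - {j}. of_int (n i) * sqrt (r i))"
    using sum0 by (simp add: sum.remove[OF \<open>finite I\<close> \<open>j \<in> I\<close>] add_eq_0_iff2)
  then have "sqrt (r j) = - (\<Sum>i\<in>I - {j}. of_int (n i) * sqrt (r i)) / of_int (n j)"
    using nz by (simp add: field_simps)
  also have "\<dots> \<in> sqrt_closure S"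
    by (auto intro!: sqrt_closure_divide sqrt_closure_uminus sqrt_closure_sum sqrt_closure.mult
        intro: sqrt_closure.Rats sqrt_closure.sqrt simp: S_def)
  finally have *: "sqrt (r j) \<in> sqrt_closure S" .
  have nd: "\<not> p dvd r j" if p: "p \<in> S" for p
  proof -
    obtain i where "i \<in> I" "i \<noteq> j" "p = r i" using p by (auto simp: S_def)
    with assms(2,3,5) show ?thesis by (metis inj_onD primes_dvd_imp_eq)
  qed
  have "\<exists>m::nat. r j = m ^ 2"
    by (rule sqrt_in_sqrt_closure_imp_square[OF _ _ nd *]) (use assms in \<open>auto simp: S_def\<close>)
  then show False
    using assms(3)[OF \<open>j \<in> I\<close>] prime_power_iff[where 'a = nat and n = 2] by auto
qed

subsection \<open>Hermite's argument\<close>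

definition ieval :: "int poly \<Rightarrow> 'a::comm_ring_1 \<Rightarrow> 'a" where
  "ieval p z = poly (map_poly of_int p) z"

lemma ieval_0 [simp]: "ieval 0 z = 0"
  by (simp add: ieval_def)

lemma ieval_pCons [simp]: "ieval (pCons a p) z = of_int a + z * ieval p z"
  by (simp add: ieval_def map_poly_pCons)

lemma ieval_1 [simp]: "ieval 1 z = 1"
  by (simp add: ieval_def)

lemma ieval_add [simp]: "ieval (p + q) z = ieval p z + ieval q z"
proof (induction p arbitrary: q)
  case (pCons a p)
  then show ?case by (cases q) (simp add: algebra_simps)
qed simp

lemma ieval_smult [simp]: "ieval (smult c p) z = of_int c * ieval p z"
  by (induction p) (simp_all add: algebra_simps)

lemma ieval_minus [simp]: "ieval (- p) z = - ieval p z"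
  using ieval_smult[of "-1" p z] by simp

lemma ieval_diff [simp]: "ieval (p - q) z = ieval p z - ieval q z"
  using ieval_add[of p "- q" z] by simp

lemma ieval_mult [simp]: "ieval (p * q) z = ieval p z * ieval q z"
  by (induction p) (simp_all add: algebra_simps)

lemma ieval_power [simp]: "ieval (p ^ n) z = ieval p z ^ n"
  by (induction n) simp_all

lemma ieval_prod [simp]: "ieval (prod f I) z = (\<Prod>i\<in>I. ieval (f i) z)"
  by (induction I rule: infinite_finite_induct) simp_all

lemma ieval_of_int: "ieval p (of_int k) = of_int (poly p k)"
  by (induction p) simp_all

lemma ieval_zero: "ieval p 0 = of_int (poly p 0)"
  using ieval_of_int[of p 0] by simp

lemma ieval_altdef: "ieval p z = (\<Sum>i\<le>degree p. of_int (coeff p i) * z ^ i)"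
proof (induction p)
  case (pCons a p)
  show ?case
  proof (cases "p = 0")
    case False
    then have "ieval (pCons a p) z = of_int a + z * (\<Sum>i\<le>degree p. of_int (coeff p i) * z ^ i)"
      using pCons by simp
    also have "\<dots> = (\<Sum>i\<le>degree (pCons a p). of_int (coeff (pCons a p) i) * z ^ i)"
      using False unfolding degree_pCons_eq[OF False]
      by (subst sum.atMost_Suc_shift) (simp add: sum_distrib_left mult_ac)
    finally show ?thesis .
  qed simp
qed simp

text \<open>The coefficients of a \<open>j\<close>-th derivative carry products of \<open>j\<close>
  consecutive integers, which \<open>fact j\<close> divides. This is the source of the factorials in
  Hermite's argument.\<close>

lemma higher_pderiv_fact_dvd:
  fixes p :: "int poly"
  obtains q where "(pderiv ^^ j) p = smult (fact j) q"
proof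
  show "(pderiv ^^ j) p = smult (fact j) (map_poly (\<lambda>c. c div fact j) ((pderiv ^^ j) p))"
    by (rule poly_eqI) (simp add: coeff_map_poly coeff_higher_pderiv fact_dvd_pochhammer)
qed

text \<open>Each differentiation lowers the multiplicity of \<open>g\<close> by at most one. For
  \<open>j \<ge> n\<close> the truncated difference is 0 and nothing is claimed.\<close>

lemma power_dvd_higher_pderiv:
  fixes g p :: "'a::idom poly"
  assumes "g ^ n dvd p"
  shows "g ^ (n - j) dvd (pderiv ^^ j) p"
proof (induction j)
  case (Suc j)
  show ?case
  proof (cases "n - j")
    case (Suc k)
    with \<open>g ^ (n - j) dvd (pderiv ^^ j) p\<close> obtain h where "(pderiv ^^ j) p = g ^ Suc k * h"
      by (metis dvdE)
    moreover have "pderiv (g ^ Suc k * h) = g ^ k * (g * pderiv h + smult (of_nat (Suc k)) (pderiv g) * h)"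
      by (subst pderiv_mult, subst pderiv_power_Suc) (simp add: algebra_simps smult_add_left)
    ultimately have "pderiv ((pderiv ^^ j) p) = g ^ k * (g * pderiv h + smult (of_nat (Suc k)) (pderiv g) * h)"
      by simp
    moreover have "n - Suc j = k" using Suc by simp
    ultimately show ?thesis by simp
  qed (use Suc in simp)
qed (use assms in simp)

text \<open>Hermite's \<open>F = f + f' + f'' + ...\<close>, cut off at order \<open>N\<close>;
  nothing is lost once \<open>N\<close> is at least the degree of \<open>f\<close>.\<close>

definition deriv_sum :: "nat \<Rightarrow> int poly \<Rightarrow> complex \<Rightarrow> complex" where
  "deriv_sum N f z = (\<Sum>j\<le>N. ieval ((pderiv ^^ j) f) z)"

text \<open>A majorant of \<open>f\<close> on the disc of radius \<open>r\<close>. Being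
  submultiplicative for \<open>r \<ge> 0\<close>, it reduces the estimate of a product of powers to
  its factors.\<close>

definition abs_ieval :: "int poly \<Rightarrow> real \<Rightarrow> real" where
  "abs_ieval f r = poly (map_poly (\<lambda>c. real_of_int \<bar>c\<bar>) f) r"

lemma abs_ieval_0 [simp]: "abs_ieval 0 r = 0"
  by (simp add: abs_ieval_def)

lemma abs_ieval_pCons [simp]: "abs_ieval (pCons a f) r = \<bar>of_int a\<bar> + r * abs_ieval f r"
  by (simp add: abs_ieval_def map_poly_pCons)

lemma abs_ieval_nonneg: "r \<ge> 0 \<Longrightarrow> abs_ieval f r \<ge> 0"
  by (induction f) auto

lemma abs_ieval_add_le: "r \<ge> 0 \<Longrightarrow> abs_ieval (f + g) r \<le> abs_ieval f r + abs_ieval g r"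
proof (induction f arbitrary: g)
  case (pCons a f)
  obtain b g' where g: "g = pCons b g'" by (cases g)
  have "r * abs_ieval (f + g') r \<le> r * (abs_ieval f r + abs_ieval g' r)"
    using pCons by (intro mult_left_mono) auto
  moreover have "\<bar>real_of_int (a + b)\<bar> \<le> \<bar>of_int a\<bar> + \<bar>of_int b\<bar>" by simp
  ultimately show ?case unfolding g by (simp add: algebra_simps)
qed simp

lemma abs_ieval_smult: "abs_ieval (smult c f) r = \<bar>of_int c\<bar> * abs_ieval f r"
  by (induction f) (simp_all add: abs_mult algebra_simps)

lemma abs_ieval_mult_le: "r \<ge> 0 \<Longrightarrow> abs_ieval (f * g) r \<le> abs_ieval f r * abs_ieval g r"
proof (induction f)
  case (pCons a f)
  have "abs_ieval (pCons a f * g) r \<le> abs_ieval (smult a g) r + abs_ieval (pCons 0 (f * g)) r"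
    unfolding mult_pCons_left using pCons.prems by (rule abs_ieval_add_le)
  also have "\<dots> \<le> \<bar>of_int a\<bar> * abs_ieval g r + r * (abs_ieval f r * abs_ieval g r)"
    using pCons by (auto simp: abs_ieval_smult intro: mult_left_mono)
  finally show ?case by (simp add: algebra_simps)
qed simp

lemma abs_ieval_power_le: "r \<ge> 0 \<Longrightarrow> abs_ieval (f ^ n) r \<le> abs_ieval f r ^ n"
proof (induction n)
  case (Suc n)
  have "abs_ieval (f ^ Suc n) r \<le> abs_ieval f r * abs_ieval (f ^ n) r"
    using Suc.prems by (simp add: abs_ieval_mult_le)
  also have "\<dots> \<le> abs_ieval f r * abs_ieval f r ^ n"
    using Suc by (intro mult_left_mono abs_ieval_nonneg) auto
  finally show ?case by simp
qed (simp add: abs_ieval_def)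

lemma abs_ieval_altdef: "abs_ieval f r = (\<Sum>i\<le>degree f. \<bar>of_int (coeff f i)\<bar> * r ^ i)"
proof (induction f)
  case (pCons a p)
  show ?case
  proof (cases "p = 0")
    case False
    then have "abs_ieval (pCons a p) r = \<bar>of_int a\<bar> + r * (\<Sum>i\<le>degree p. \<bar>of_int (coeff p i)\<bar> * r ^ i)"
      using pCons by simp
    also have "\<dots> = (\<Sum>i\<le>degree (pCons a p). \<bar>of_int (coeff (pCons a p) i)\<bar> * r ^ i)"
      using False unfolding degree_pCons_eq[OF False]
      by (subst sum.atMost_Suc_shift) (simp add: sum_distrib_left mult_ac)
    finally show ?thesis .
  qed simp
qed simp

section \<open>Hermite's estimate, monomial by monomial\<close>

lemma higher_pderiv_monom_int:
  "j \<le> m \<Longrightarrow> (pderiv ^^ j) (monom (1::int) m) = monom (fact m div fact (m - j)) (m - j)"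
proof (induction j)
  case (Suc j)
  then have *: "m - j = Suc (m - Suc j)" by simp
  have "(pderiv ^^ Suc j) (monom (1::int) m) = monom (int (m - j) * (fact m div fact (m - j))) (m - Suc j)"
    using Suc by (simp add: pderiv_monom)
  also have "int (m - j) * (fact m div fact (m - j)) = fact m div fact (m - Suc j)"
  proof -
    have "fact (m - j) dvd (fact m :: int)" by (rule fact_dvd) simp
    then obtain c where c: "fact m = fact (m - j) * (c::int)" by blast
    have "fact (m - j) = int (m - j) * fact (m - Suc j)" unfolding * by simp
    then have "fact m = (int (m - j) * c) * fact (m - Suc j)" using c by simp
    moreover have "fact m div fact (m - j) = c" using c by simp
    ultimately show ?thesis by simp
  qed
  finally show ?case .
qed simp

lemma ieval_monom: "ieval (monom c m) z = of_int c * z ^ m"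
  by (simp add: ieval_def map_poly_monom poly_monom)

text \<open>The derivative of order \<open>j\<close> contributes
  \<open>z ^ (m - j) / fact (m - j)\<close>, so up to the factor \<open>fact m\<close> the Taylor
  polynomial of \<open>exp\<close> appears, read backwards.\<close>

lemma deriv_sum_monom:
  assumes "m \<le> N"
  shows "deriv_sum N (monom 1 m) z = fact m * (\<Sum>i\<le>m. z ^ i / fact i)"
proof -
  have "deriv_sum N (monom 1 m) z = (\<Sum>j\<le>m. ieval ((pderiv ^^ j) (monom 1 m)) z)"
    unfolding deriv_sum_def
  proof (rule sum.mono_neutral_right)
    show "\<forall>i\<in>{..N} - {..m}. ieval ((pderiv ^^ i) (monom 1 m)) z = 0"
    proof
      fix i assume "i \<in> {..N} - {..m}"
      then have i: "i = Suc (i - Suc m) + m" by simp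
      have "(pderiv ^^ i) (monom (1::int) m) = (pderiv ^^ Suc (i - Suc m)) ((pderiv ^^ m) (monom 1 m))"
        by (subst i) (simp only: funpow_add o_def)
      then show "ieval ((pderiv ^^ i) (monom 1 m)) z = 0"
        by (simp add: higher_pderiv_monom_int monom_0 funpow_Suc_right pderiv_pCons
            del: funpow.simps)
    qed
  qed (use assms in auto)
  also have "\<dots> = (\<Sum>j\<le>m. fact m * (z ^ (m - j) / fact (m - j)))"
  proof (rule sum.cong)
    fix j assume j: "j \<in> {..m}"
    have "fact (m - j) dvd (fact m :: int)" by (rule fact_dvd) simp
    then have "complex_of_int (fact m div fact (m - j)) = of_int (fact m) / of_int (fact (m - j))"
      by (rule of_int_div)
    then show "ieval ((pderiv ^^ j) (monom 1 m)) z = fact m * (z ^ (m - j) / fact (m - j))"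
      using j by (simp add: higher_pderiv_monom_int ieval_monom)
  qed simp
  also have "\<dots> = (\<Sum>i\<le>m. fact m * (z ^ i / fact i))"
    by (rule sum.reindex_bij_witness[of _ "\<lambda>i. m - i" "\<lambda>i. m - i"]) auto
  finally show ?thesis by (simp add: sum_distrib_left)
qed

lemma deriv_sum_0: "deriv_sum N 0 z = 0"
  by (simp add: deriv_sum_def)

lemma deriv_sum_add: "deriv_sum N (f + g) z = deriv_sum N f z + deriv_sum N g z"
  by (simp add: deriv_sum_def higher_pderiv_add sum.distrib)

lemma deriv_sum_smult: "deriv_sum N (smult c f) z = of_int c * deriv_sum N f z"
  by (simp add: deriv_sum_def higher_pderiv_smult sum_distrib_left)

lemma deriv_sum_sum: "finite I \<Longrightarrow> deriv_sum N (sum f I) z = (\<Sum>i\<in>I. deriv_sum N (f i) z)"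
  by (induction I rule: finite_induct) (simp_all add: deriv_sum_add deriv_sum_0)

text \<open>The left-hand side is Hermite's integral of \<open>e\<^bsup>z - u\<^esup> f(u)\<close> from 0 to \<open>z\<close>; comparing Taylor
  polynomials of \<open>exp\<close> monomial by monomial avoids the integral.\<close>
lemma deriv_sum_bound:
  assumes "degree f \<le> N"
  shows "norm (exp z * deriv_sum N f 0 - deriv_sum N f z) \<le> exp (norm z) * norm z * abs_ieval f (norm z)"
proof -
  define E where "E = (\<lambda>f. exp z * deriv_sum N f 0 - deriv_sum N f z)"
  have f: "f = (\<Sum>m\<le>degree f. smult (coeff f m) (monom 1 m))"
    by (simp add: smult_monom poly_as_sum_of_monoms)
  have "E f = (\<Sum>m\<le>degree f. of_int (coeff f m) * E (monom 1 m))"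
    unfolding E_def
    by (subst (1 2) f) (simp add: deriv_sum_sum deriv_sum_smult sum_distrib_left
          sum_subtractf[symmetric] algebra_simps del: sum_subtractf)
  also have "norm \<dots> \<le> (\<Sum>m\<le>degree f. \<bar>of_int (coeff f m)\<bar> * (exp (norm z) * norm z ^ Suc m))"
  proof (rule order.trans[OF norm_sum sum_mono])
    fix m assume "m \<in> {..degree f}"
    then have m: "m \<le> N" using assms by simp
    \<comment> \<open>At 0 the Taylor polynomial reduces to its term \<open>i = 0\<close>, with
      \<open>0 ^ 0 = 1\<close>.\<close>
    have "(\<Sum>i\<le>m. 0 ^ i / fact i) = (1::complex)"
      by (simp add: power_0_left if_distrib[of "\<lambda>x. x / _"] sum.delta cong: if_cong)
    then have "E (monom 1 m) = fact m * (exp z - (\<Sum>i\<le>m. z ^ i / fact i))"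
      unfolding E_def deriv_sum_monom[OF m] by (simp add: algebra_simps)
    \<comment> \<open>The Taylor remainder bound has the denominator \<open>fact m\<close>, which
      cancels the factor in front.\<close>
    then have "norm (E (monom 1 m)) \<le> fact m * (exp (norm z) * norm z ^ Suc m / fact m)"
      by (simp only: norm_mult norm_fact) (intro mult_left_mono Taylor_exp_field, simp)
    then have "norm (E (monom 1 m)) \<le> exp (norm z) * norm z ^ Suc m" by simp
    then show "norm (of_int (coeff f m) * E (monom 1 m)) \<le> \<bar>of_int (coeff f m)\<bar> * (exp (norm z) * norm z ^ Suc m)"
      unfolding norm_mult norm_of_int by (rule mult_left_mono) simp
  qed
  also have "\<dots> = exp (norm z) * norm z * abs_ieval f (norm z)"
    by (simp add: abs_ieval_altdef sum_distrib_left mult_ac)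
  finally show ?thesis unfolding E_def .
qed

lemma fact_eventually_dominates:
  fixes C L :: real
  shows "eventually (\<lambda>n. C * L ^ n < fact n) sequentially"
proof -
  have "(\<lambda>n. L ^ n / fact n) \<longlonglongrightarrow> 0"
    using summable_LIMSEQ_zero[OF summable_exp[of L]] by (simp add: field_simps)
  then have "(\<lambda>n. C * (L ^ n / fact n)) \<longlonglongrightarrow> C * 0" by (intro tendsto_intros)
  then have "eventually (\<lambda>n. C * (L ^ n / fact n) < 1) sequentially"
    by (rule order_tendstoD) simp
  then show ?thesis
    by eventually_elim (simp add: field_simps)
qed

section \<open>Integrality and divisibility of weighted sums of derivatives\<close>

lemma sum_ieval_in_Ints:
  fixes \<alpha> :: "'i \<Rightarrow> 'a::comm_ring_1"
  assumes "\<And>m. (\<Sum>i\<in>I. of_int (b i) * \<alpha> i ^ m) \<in> \<int>"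
  shows "(\<Sum>i\<in>I. of_int (b i) * ieval q (\<alpha> i)) \<in> \<int>"
proof -
  have "(\<Sum>i\<in>I. of_int (b i) * ieval q (\<alpha> i)) =
      (\<Sum>m\<le>degree q. of_int (coeff q m) * (\<Sum>i\<in>I. of_int (b i) * \<alpha> i ^ m))"
    unfolding ieval_altdef sum_distrib_left by (subst sum.swap) (simp add: mult_ac)
  also have "\<dots> \<in> \<int>" by (intro Ints_sum Ints_mult assms) auto
  finally show ?thesis .
qed

text \<open>A derivative of order \<open>j \<ge> p\<close> is \<open>fact j\<close>, hence a
  multiple of \<open>fact p\<close>, times an integer polynomial, whose weighted sum over the
  \<open>\<alpha> i\<close> is an integer.\<close>

lemma dvd_sum_higher_pderiv:
  fixes \<alpha> :: "'i \<Rightarrow> 'a::comm_ring_1"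
  assumes "\<And>m. (\<Sum>i\<in>I. of_int (b i) * \<alpha> i ^ m) \<in> \<int>"
  obtains M where "(\<Sum>j=p..N. \<Sum>i\<in>I. of_int (b i) * ieval ((pderiv ^^ j) f) (\<alpha> i)) = of_int (fact p * M)"
proof -
  have "\<exists>M. (\<Sum>i\<in>I. of_int (b i) * ieval ((pderiv ^^ j) f) (\<alpha> i)) = of_int (fact p * M)"
    if j: "j \<in> {p..N}" for j
  proof -
    obtain q where q: "(pderiv ^^ j) f = smult (fact j) q" by (rule higher_pderiv_fact_dvd)
    obtain k where k: "(\<Sum>i\<in>I. of_int (b i) * ieval q (\<alpha> i)) = of_int k"
      using sum_ieval_in_Ints[where b = b and \<alpha> = \<alpha> and I = I and q = q, OF assms] by (auto elim: Ints_cases)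
    have "fact p dvd (fact j :: int)" using j by (intro fact_dvd) auto
    then obtain c where c: "fact j = fact p * (c::int)" by blast
    have "(\<Sum>i\<in>I. of_int (b i) * ieval ((pderiv ^^ j) f) (\<alpha> i)) =
        of_int (fact j) * (\<Sum>i\<in>I. of_int (b i) * ieval q (\<alpha> i))"
      by (simp add: q sum_distrib_left mult_ac del: of_int_fact)
    also have "\<dots> = of_int (fact p * (c * k))" unfolding c k by (simp add: mult_ac)
    finally show ?thesis by blast
  qed
  then obtain M where "\<And>j. j \<in> {p..N} \<Longrightarrow>
      (\<Sum>i\<in>I. of_int (b i) * ieval ((pderiv ^^ j) f) (\<alpha> i)) = of_int (fact p * M j)"
    by metis
  then have "(\<Sum>j=p..N. \<Sum>i\<in>I. of_int (b i) * ieval ((pderiv ^^ j) f) (\<alpha> i)) =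
      of_int (fact p * (\<Sum>j=p..N. M j))"
    by (simp add: sum_distrib_left)
  with that show ?thesis by blast
qed

text \<open>Let \<open>F\<close> belong to \<open>f = X^(p-1) g^p\<close>. If the sum were zero,
  \<open>b0 * F(0)\<close> plus the weighted \<open>F(\<alpha> i)\<close> would be an integer
  \<open>(p-1)! * K\<close> smaller than \<open>(p-1)!\<close> in absolute value, although the large
  prime \<open>p\<close> does not divide \<open>K\<close>.\<close>

theorem hermite_lindemann_symmetric:
  fixes \<alpha> :: "'i \<Rightarrow> complex" and b :: "'i \<Rightarrow> int"
  assumes "finite I" and "b0 \<noteq> 0"
    and ints: "\<And>m. (\<Sum>i\<in>I. of_int (b i) * \<alpha> i ^ m) \<in> \<int>"
    and g: "\<And>i. i \<in> I \<Longrightarrow> ieval g (\<alpha> i) = 0" and g0: "poly g 0 \<noteq> 0"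
  shows "of_int b0 + (\<Sum>i\<in>I. of_int (b i) * exp (\<alpha> i)) \<noteq> 0"
proof
  assume zero: "of_int b0 + (\<Sum>i\<in>I. of_int (b i) * exp (\<alpha> i)) = 0"
  define r where "r = (\<lambda>i. norm (\<alpha> i))"
  define G where "G = (\<lambda>i. abs_ieval g (r i))"
  \<comment> \<open>As \<open>p = Suc n\<close>, one factor \<open>G i\<close> goes into the
    constant \<open>C i\<close>, leaving the pure power \<open>(r i * G i) ^ n\<close>;
    \<open>L\<close> bounds all these bases at once.\<close>
  define C where "C = (\<lambda>i. \<bar>of_int (b i)\<bar> * (exp (r i) * r i * G i))"
  define L where "L = (\<Sum>i\<in>I. r i * G i)"
  have r: "r i \<ge> 0" and G: "G i \<ge> 0" for i
    by (auto simp: r_def G_def intro: abs_ieval_nonneg)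
  have C: "C i \<ge> 0" for i using r G by (simp add: C_def)
  obtain n0 where n0: "\<And>n. n \<ge> n0 \<Longrightarrow> (\<Sum>i\<in>I. C i) * L ^ n < fact n"
    using fact_eventually_dominates unfolding eventually_sequentially by blast
  \<comment> \<open>Exceeding the absolute values of \<open>b0\<close> and \<open>poly g 0\<close>
    makes \<open>p\<close> divide neither; exceeding \<open>n0\<close> makes the estimate available
    for \<open>n = p - 1\<close>.\<close>
  obtain p where p: "prime p" "p > n0 + nat \<bar>b0\<bar> + nat \<bar>poly g 0\<bar>"
    using bigger_prime by blast
  define n where "n = p - 1"
  have pn: "p = Suc n" using p(2) by (simp add: n_def)
  define f where "f = monom 1 n * g ^ p"
  \<comment> \<open>The summand \<open>p\<close> ensures \<open>p \<le> N\<close>, so that the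
    orders can be split at \<open>p\<close>.\<close>
  define N where "N = degree f + p"
  define D where "D = deriv_sum N f"
  have split: "{..N} = {..<p} \<union> {p..N}" "{..<p} \<inter> {p..N} = {}"
    by (auto simp: N_def)
  obtain M0 where M0: "D 0 = of_int (fact n * poly g 0 ^ p + fact p * M0)"
  proof -
    \<comment> \<open>The value at 0 is treated as a weighted sum over a one-element index
      set.\<close>
    have "(\<Sum>i\<in>{()}. of_int 1 * (0::complex) ^ m) \<in> \<int>" for m by simp
    from dvd_sum_higher_pderiv[where b = "\<lambda>_. 1" and \<alpha> = "\<lambda>_. 0" and I = "{()}" and p = p and N = N and f = f, OF this]
    obtain M where M: "(\<Sum>j=p..N. ieval ((pderiv ^^ j) f) (0::complex)) = of_int (fact p * M)"
      by auto
    \<comment> \<open>\<open>X^n\<close> divides \<open>f\<close>, so below order \<open>p\<close>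
      only the derivative of order \<open>n\<close> survives at 0; it contributes the factor
      \<open>fact n\<close> instead of \<open>fact p\<close>.\<close>
    have "poly ((pderiv ^^ j) f) 0 = 0" if "j < n" for j
    proof -
      have "[:0, 1:] ^ n dvd f" by (simp add: f_def monom_altdef)
      then have "[:0, 1:] ^ (n - j) dvd (pderiv ^^ j) f" by (rule power_dvd_higher_pderiv)
      then have "[:0, 1:] dvd (pderiv ^^ j) f"
        using that by (meson dvd_power dvd_trans zero_less_diff)
      then show ?thesis by (auto simp: dvd_def)
    qed
    then have "(\<Sum>j<p. ieval ((pderiv ^^ j) f) 0) = (of_int (poly ((pderiv ^^ n) f) 0) :: complex)"
      unfolding pn by (simp add: ieval_zero)
    moreover have "poly ((pderiv ^^ n) f) 0 = fact n * poly g 0 ^ p"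
      by (simp add: poly_0_coeff_0 coeff_higher_pderiv f_def coeff_monom_mult
          pochhammer_fact[symmetric] coeff_0_power)
    ultimately have "D 0 = of_int (fact n * poly g 0 ^ p + fact p * M)"
      unfolding D_def deriv_sum_def split(1) by (subst sum.union_disjoint) (auto simp: M)
    with that show ?thesis by blast
  qed
  obtain M1 where M1: "(\<Sum>i\<in>I. of_int (b i) * D (\<alpha> i)) = of_int (fact p * M1)"
  proof -
    obtain M where M: "(\<Sum>j=p..N. \<Sum>i\<in>I. of_int (b i) * ieval ((pderiv ^^ j) f) (\<alpha> i)) = of_int (fact p * M)"
      using dvd_sum_higher_pderiv[where b = b and \<alpha> = \<alpha> and I = I and p = p and N = N and f = f, OF ints] by blast
    \<comment> \<open>At the roots of \<open>g\<close> the factor \<open>g ^ p\<close> kills all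
      orders below \<open>p\<close>, so every remaining term carries \<open>fact p\<close>.\<close>
    have *: "ieval ((pderiv ^^ j) f) (\<alpha> i) = 0" if "j < p" "i \<in> I" for i j
    proof -
      have "g ^ p dvd f" by (simp add: f_def)
      then have "g ^ (p - j) dvd (pderiv ^^ j) f" by (rule power_dvd_higher_pderiv)
      then have "g dvd (pderiv ^^ j) f"
        using that by (meson dvd_power dvd_trans zero_less_diff)
      then show ?thesis using g[OF that(2)] by (auto simp: dvd_def)
    qed
    have "D (\<alpha> i) = (\<Sum>j=p..N. ieval ((pderiv ^^ j) f) (\<alpha> i))" if "i \<in> I" for i
      unfolding D_def deriv_sum_def split(1) using that
      by (subst sum.union_disjoint) (auto simp: *)
    then have "(\<Sum>i\<in>I. of_int (b i) * D (\<alpha> i)) =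
        (\<Sum>i\<in>I. \<Sum>j=p..N. of_int (b i) * ieval ((pderiv ^^ j) f) (\<alpha> i))"
      by (simp add: sum_distrib_left)
    also have "\<dots> = of_int (fact p * M)" by (subst sum.swap) (rule M)
    finally show ?thesis by (rule that)
  qed
  \<comment> \<open>Modulo \<open>p\<close> only \<open>b0 * poly g 0 ^ p\<close> remains of
    \<open>K\<close>; the other terms gain a factor \<open>p\<close> from
    \<open>fact p = p * fact n\<close>.\<close>
  define K where "K = b0 * poly g 0 ^ p + int p * (b0 * M0 + M1)"
  have "of_int (fact n * K) = of_int b0 * D 0 + (\<Sum>i\<in>I. of_int (b i) * D (\<alpha> i))"
    unfolding M0 M1 K_def pn by (simp add: algebra_simps)
  \<comment> \<open>The assumed relation, multiplied by \<open>D 0\<close>, trades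
    \<open>of_int b0 * D 0\<close> for exponentials and produces the differences that
    \<open>deriv_sum_bound\<close> controls.\<close>
  also have "\<dots> = - (\<Sum>i\<in>I. of_int (b i) * (exp (\<alpha> i) * D 0 - D (\<alpha> i)))"
  proof -
    have "(of_int b0 + (\<Sum>i\<in>I. of_int (b i) * exp (\<alpha> i))) * D 0 = 0" using zero by simp
    then show ?thesis
      by (simp add: algebra_simps sum_subtractf sum_distrib_left sum_distrib_right)
  qed
  also have "norm \<dots> \<le> (\<Sum>i\<in>I. C i * (r i * G i) ^ n)"
    unfolding norm_minus_cancel
  proof (rule order.trans[OF norm_sum sum_mono])
    fix i assume "i \<in> I"
    have "norm (exp (\<alpha> i) * D 0 - D (\<alpha> i)) \<le> exp (r i) * r i * abs_ieval f (r i)"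
      unfolding D_def r_def by (rule deriv_sum_bound) (simp add: N_def)
    also have "abs_ieval f (r i) \<le> abs_ieval (monom 1 n) (r i) * abs_ieval (g ^ p) (r i)"
      unfolding f_def by (rule abs_ieval_mult_le[OF r])
    also have "\<dots> \<le> r i ^ n * G i ^ p"
      unfolding G_def using r
      by (intro mult_mono abs_ieval_power_le abs_ieval_nonneg)
         (auto simp: abs_ieval_def map_poly_monom poly_monom)
    finally have "norm (exp (\<alpha> i) * D 0 - D (\<alpha> i)) \<le> exp (r i) * r i * (r i ^ n * G i ^ p)"
      using r by (simp add: mult_left_mono)
    then have "norm (of_int (b i) * (exp (\<alpha> i) * D 0 - D (\<alpha> i))) \<le>
        \<bar>of_int (b i)\<bar> * (exp (r i) * r i * (r i ^ n * G i ^ p))"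
      unfolding norm_mult norm_of_int by (rule mult_left_mono) simp
    also have "\<dots> = C i * (r i * G i) ^ n"
      by (simp add: C_def pn power_mult_distrib)
    finally show "norm (of_int (b i) * (exp (\<alpha> i) * D 0 - D (\<alpha> i))) \<le> C i * (r i * G i) ^ n" .
  qed
  also have "\<dots> \<le> (\<Sum>i\<in>I. C i * L ^ n)"
    unfolding L_def using r G C \<open>finite I\<close>
    by (intro sum_mono mult_left_mono power_mono member_le_sum) auto
  also have "\<dots> < fact n"
    using n0[of n] p(2) by (simp add: sum_distrib_right n_def)
  finally have "\<bar>real_of_int (fact n * K)\<bar> < fact n"
    by (simp only: norm_of_int)
  then have "fact n * \<bar>real_of_int K\<bar> < fact n * 1" by (simp add: abs_mult)
  then have "K = 0" unfolding mult_less_cancel_left_pos[OF fact_gt_zero] by linarith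
  then have "b0 * poly g 0 ^ p = int p * - (b0 * M0 + M1)"
    unfolding K_def by (simp add: algebra_simps)
  then have "int p dvd b0 * poly g 0 ^ p" by (rule dvdI)
  then have "int p dvd b0 \<or> int p dvd poly g 0"
    using p(1) by (metis prime_dvd_mult_iff prime_dvd_power prime_int_nat_transfer nat_int int_int_eq prime_nat_int_transfer)
  then show False
    using p(2) dvd_imp_le_int[OF \<open>b0 \<noteq> 0\<close>, of "int p"] dvd_imp_le_int[OF g0, of "int p"] by linarith
qed

subsection \<open>Symmetrization in the group ring\<close>

abbreviation fun_support :: "('a \<Rightarrow> 'b::zero) \<Rightarrow> 'a set" where
  "fun_support b \<equiv> {n. b n \<noteq> 0}"

text \<open>Multiplication in the integral group ring, whose elements are the functions of finite
  support.\<close>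

definition convolution :: "('g::ab_group_add \<Rightarrow> int) \<Rightarrow> ('g \<Rightarrow> int) \<Rightarrow> 'g \<Rightarrow> int" where
  "convolution b c n = (\<Sum>m\<in>fun_support b. b m * c (n - m))"

text \<open>For multiplicative \<open>\<mu>\<close> this is the induced additive and multiplicative
  map on the group ring; with exponentials as \<open>\<mu>\<close>, its zeros are the vanishing
  combinations.\<close>

definition evaluation :: "('g \<Rightarrow> 'a::comm_ring_1) \<Rightarrow> ('g \<Rightarrow> int) \<Rightarrow> 'a" where
  "evaluation \<mu> b = (\<Sum>n\<in>fun_support b. of_int (b n) * \<mu> n)"

lemma convolution_support:
  "fun_support (convolution b c) \<subseteq> (\<lambda>(m, k). m + k) ` (fun_support b \<times> fun_support c)"
proof
  fix n assume "n \<in> fun_support (convolution b c)"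
  then have "(\<Sum>m\<in>fun_support b. b m * c (n - m)) \<noteq> 0" by (simp add: convolution_def)
  then obtain m where "b m \<noteq> 0" "b m * c (n - m) \<noteq> 0" by (auto elim: sum.not_neutral_contains_not_neutral)
  then show "n \<in> (\<lambda>(m, k). m + k) ` (fun_support b \<times> fun_support c)"
    by (intro image_eqI[of _ _ "(m, n - m)"]) auto
qed

lemma finite_convolution_support:
  "finite (fun_support b) \<Longrightarrow> finite (fun_support c) \<Longrightarrow> finite (fun_support (convolution b c))"
  by (rule finite_subset[OF convolution_support]) auto

lemma evaluation_superset:
  "finite S \<Longrightarrow> fun_support b \<subseteq> S \<Longrightarrow> evaluation \<mu> b = (\<Sum>n\<in>S. of_int (b n) * \<mu> n)"
  unfolding evaluation_def by (rule sum.mono_neutral_left) auto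

text \<open>For fixed \<open>m\<close>, shifting the summation index by \<open>m\<close> pulls out
  the factor \<open>\<mu> m\<close>; the set \<open>T\<close> contains every shifted
  support.\<close>

lemma evaluation_convolution:
  assumes fin: "finite (fun_support b)" "finite (fun_support c)"
    and \<mu>: "\<And>m k. \<mu> (m + k) = \<mu> m * \<mu> k"
  shows "evaluation \<mu> (convolution b c) = evaluation \<mu> b * evaluation \<mu> c"
proof -
  define T where "T = (\<lambda>(m, k). m + k) ` (fun_support b \<times> fun_support c)"
  have T: "finite T" unfolding T_def using fin by auto
  have inner: "(\<Sum>n\<in>T. of_int (c (n - m)) * \<mu> n) = \<mu> m * evaluation \<mu> c"
    if m: "m \<in> fun_support b" for m
  proof -
    have "(\<Sum>n\<in>T. of_int (c (n - m)) * \<mu> n) = (\<Sum>n\<in>(+) m ` fun_support c. of_int (c (n - m)) * \<mu> n)"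
    proof (rule sum.mono_neutral_right[OF T])
      show "\<forall>n\<in>T - (+) m ` fun_support c. of_int (c (n - m)) * \<mu> n = 0"
      proof
        fix n assume "n \<in> T - (+) m ` fun_support c"
        moreover have "n \<in> (+) m ` fun_support c" if "c (n - m) \<noteq> 0"
          using that by (intro image_eqI[of _ _ "n - m"]) auto
        ultimately show "of_int (c (n - m)) * \<mu> n = 0" by (cases "c (n - m) = 0") auto
      qed
    qed (use m in \<open>auto simp: T_def\<close>)
    also have "\<dots> = (\<Sum>k\<in>fun_support c. of_int (c k) * (\<mu> m * \<mu> k))"
      by (subst sum.reindex) (auto simp: \<mu> inj_on_def)
    finally show ?thesis by (simp add: evaluation_def sum_distrib_left mult_ac)
  qed
  have "evaluation \<mu> (convolution b c) = (\<Sum>n\<in>T. of_int (convolution b c n) * \<mu> n)"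
    using convolution_support[of b c] T by (intro evaluation_superset) (auto simp: T_def)
  also have "\<dots> = (\<Sum>m\<in>fun_support b. of_int (b m) * (\<Sum>n\<in>T. of_int (c (n - m)) * \<mu> n))"
    unfolding convolution_def of_int_sum of_int_mult sum_distrib_left sum_distrib_right
    by (subst sum.swap) (simp add: mult_ac)
  also have "\<dots> = (\<Sum>m\<in>fun_support b. of_int (b m) * (\<mu> m * evaluation \<mu> c))"
    by (intro sum.cong) (simp_all only: inner)
  finally show ?thesis by (simp add: evaluation_def sum_distrib_right mult_ac)
qed

lemma convolution_commute:
  assumes fin: "finite (fun_support b)" "finite (fun_support c)"
  shows "convolution b c = convolution c b"
proof
  fix n
  have "convolution b c n = (\<Sum>m | b m \<noteq> 0 \<and> c (n - m) \<noteq> 0. b m * c (n - m))"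
    unfolding convolution_def using fin by (intro sum.mono_neutral_right) auto
  also have "\<dots> = (\<Sum>m | c m \<noteq> 0 \<and> b (n - m) \<noteq> 0. c m * b (n - m))"
    by (rule sum.reindex_bij_witness[of _ "\<lambda>m. n - m" "\<lambda>m. n - m"]) auto
  also have "\<dots> = convolution c b n"
    unfolding convolution_def using fin by (intro sum.mono_neutral_left) auto
  finally show "convolution b c n = convolution c b n" .
qed

lemma convolution_automorphism:
  assumes \<phi>: "\<And>m. \<phi> (\<phi> m) = m" "\<And>m n. \<phi> (m - n) = \<phi> m - \<phi> n"
  shows "convolution (b \<circ> \<phi>) (c \<circ> \<phi>) = convolution b c \<circ> \<phi>"
proof
  fix n
  show "convolution (b \<circ> \<phi>) (c \<circ> \<phi>) n = (convolution b c \<circ> \<phi>) n"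
    unfolding convolution_def o_def
    by (rule sum.reindex_bij_witness[of _ \<phi> \<phi>]) (auto simp: \<phi>)
qed

text \<open>An additive embedding into the ordered group of the reals makes the leading terms multiply.\<close>
lemma convolution_nonzero:
  fixes ord :: "'g::ab_group_add \<Rightarrow> real" and b c :: "'g \<Rightarrow> int"
  assumes fin: "finite (fun_support b)" "finite (fun_support c)"
    and ne: "fun_support b \<noteq> {}" "fun_support c \<noteq> {}"
    and ord: "\<And>m k. ord (m + k) = ord m + ord k" "inj ord"
  shows "fun_support (convolution b c) \<noteq> {}"
proof -
  have max: "\<exists>m\<in>S. \<forall>k\<in>S. ord k \<le> ord m" if "finite S" "S \<noteq> {}" for S :: "'g set"
  proof -
    have "Max (ord ` S) \<in> ord ` S" using that by (intro Max_in) auto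
    then obtain m where "m \<in> S" "Max (ord ` S) = ord m" by blast
    moreover have "ord k \<le> Max (ord ` S)" if "k \<in> S" for k using that \<open>finite S\<close> by simp
    ultimately show ?thesis by auto
  qed
  obtain m where m: "b m \<noteq> 0" "\<And>k. b k \<noteq> 0 \<Longrightarrow> ord k \<le> ord m" using max[OF fin(1) ne(1)] by blast
  obtain l where l: "c l \<noteq> 0" "\<And>k. c k \<noteq> 0 \<Longrightarrow> ord k \<le> ord l" using max[OF fin(2) ne(2)] by blast
  \<comment> \<open>If \<open>k\<close> and \<open>m + l - k\<close> lie in the supports, their
    orders are at most \<open>ord m\<close> and \<open>ord l\<close> with the same total, which
    forces \<open>k = m\<close>.\<close>
  have "convolution b c (m + l) = (\<Sum>k\<in>{m}. b k * c (m + l - k))"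
    unfolding convolution_def
  proof (rule sum.mono_neutral_right[OF fin(1)])
    show "\<forall>k\<in>fun_support b - {m}. b k * c (m + l - k) = 0"
    proof (rule ballI, rule ccontr)
      fix k assume k: "k \<in> fun_support b - {m}" "b k * c (m + l - k) \<noteq> 0"
      have "ord k < ord m" using k m(2)[of k] ord(2) by (auto simp: inj_def less_le)
      moreover have "ord (m + l - k) \<le> ord l" using k l(2) by simp
      moreover have "ord (m + l - k) + ord k = ord m + ord l"
        by (metis diff_add_cancel ord(1))
      ultimately show False by simp
    qed
  qed (use m in auto)
  then have "convolution b c (m + l) \<noteq> 0" using m l by simp
  then show ?thesis by blast
qed

text \<open>On the exponents this is the Galois conjugation that changes the sign of one square
  root.\<close>

definition reflect :: "'n \<Rightarrow> int ^ 'n \<Rightarrow> int ^ 'n::finite" where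
  "reflect k n = (\<chi> i. if i = k then - n $ i else n $ i)"

lemma reflect_reflect [simp]: "reflect k (reflect k n) = n"
  by (simp add: reflect_def vec_eq_iff)

lemma reflect_commute: "reflect k (reflect j n) = reflect j (reflect k n)"
  by (simp add: reflect_def vec_eq_iff)

lemma reflect_diff: "reflect k (m - n) = reflect k m - reflect k n"
  by (simp add: reflect_def vec_eq_iff)

lemma reflect_0 [simp]: "reflect k 0 = 0"
  by (simp add: reflect_def vec_eq_iff)

lemma reflect_eq_0_iff [simp]: "reflect k n = 0 \<longleftrightarrow> n = 0"
  by (metis reflect_0 reflect_reflect)

text \<open>Negation is the product of all coordinate reflections; the induction is on the set
  \<open>K\<close> of coordinates negated so far.\<close>

lemma reflect_invariant_uminus:
  fixes b :: "int ^ 'n::finite \<Rightarrow> 'a"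
  assumes "\<And>k n. b (reflect k n) = b n"
  shows "b (- n) = b n"
proof -
  have "b (\<chi> i. if i \<in> K then - n $ i else n $ i) = b n" if "finite K" for K
    using that
  proof (induction K)
    case (insert k K)
    have "(\<chi> i. if i \<in> insert k K then - n $ i else n $ i) =
        reflect k (\<chi> i. if i \<in> K then - n $ i else n $ i)"
      using insert.hyps by (auto simp: reflect_def vec_eq_iff)
    then show ?case using insert.IH assms by simp
  qed simp
  from this[of UNIV] show ?thesis by (simp add: uminus_vec_def)
qed

text \<open>The product of the conjugates of an element of the group ring under all sign changes is
  invariant; multiplying its conjugates in one coordinate at a time avoids indexing them.\<close>
lemma symmetrize:
  fixes ord :: "int ^ 'n::finite \<Rightarrow> real" and \<mu> :: "int ^ 'n \<Rightarrow> 'a::comm_ring_1"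
  assumes "finite (fun_support b)" "fun_support b \<noteq> {}" "evaluation \<mu> b = 0"
    and ord: "\<And>m k. ord (m + k) = ord m + ord k" "inj ord"
    and \<mu>: "\<And>m k. \<mu> (m + k) = \<mu> m * \<mu> k"
  obtains c where "finite (fun_support c)" "c 0 \<noteq> 0" "evaluation \<mu> c = 0"
    "\<And>k n. c (reflect k n) = c n"
proof -
  have "\<exists>c. finite (fun_support c) \<and> fun_support c \<noteq> {} \<and> evaluation \<mu> c = 0 \<and> (\<forall>k\<in>K. c \<circ> reflect k = c)"
    if "finite K" for K
    using that
  proof (induction K)
    case empty
    then show ?case using assms(1-3) by blast
  next
    case (insert k K)
    then obtain c where c: "finite (fun_support c)" "fun_support c \<noteq> {}" "evaluation \<mu> c = 0"
      and inv: "\<And>j. j \<in> K \<Longrightarrow> c \<circ> reflect j = c" by blast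
    \<comment> \<open>In the product of \<open>c\<close> with its conjugate,
      \<open>reflect k\<close> merely swaps the factors, and the invariances collected so far
      persist because reflections commute.\<close>
    define c' where "c' = c \<circ> reflect k"
    have supp: "fun_support c' = reflect k ` fun_support c"
      unfolding c'_def by (auto intro: image_eqI[of _ "reflect k" "reflect k _"])
    have c': "finite (fun_support c')" "fun_support c' \<noteq> {}"
      unfolding supp using c by auto
    define d where "d = convolution c c'"
    have equivar: "convolution (f \<circ> reflect j) (h \<circ> reflect j) = convolution f h \<circ> reflect j" for f h j
      by (rule convolution_automorphism) (simp_all add: reflect_diff)
    have "d \<circ> reflect j = d" if "j \<in> insert k K" for j
    proof (cases "j = k")
      case True
      have "c' \<circ> reflect k = c" by (simp add: c'_def fun_eq_iff)
      then have "d \<circ> reflect k = convolution c' c"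
        unfolding d_def equivar[symmetric] by (simp add: c'_def)
      also have "\<dots> = d" unfolding d_def by (rule convolution_commute[OF c'(1) c(1)])
      finally show ?thesis using True by simp
    next
      case False
      then have j: "c \<circ> reflect j = c" using that inv by simp
      then have "c' \<circ> reflect j = c'"
        by (simp add: c'_def fun_eq_iff) (metis reflect_commute)
      then show ?thesis unfolding d_def equivar[symmetric] by (simp add: j)
    qed
    moreover have "finite (fun_support d)"
      unfolding d_def by (intro finite_convolution_support c c')
    moreover have "fun_support d \<noteq> {}"
      unfolding d_def by (rule convolution_nonzero[OF c(1) c'(1) c(2) c'(2) ord])
    moreover have "evaluation \<mu> d = 0"
      unfolding d_def using evaluation_convolution[of c c' \<mu>, OF c(1) c'(1) \<mu>] c(3) by simp
    ultimately show ?case by blast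
  qed
  from this[of UNIV] obtain c where c: "finite (fun_support c)" "fun_support c \<noteq> {}" "evaluation \<mu> c = 0"
    and inv: "\<And>k. c \<circ> reflect k = c" by auto
  have inv': "c (reflect k n) = c n" for k n using inv[of k] by (simp add: fun_eq_iff)
  \<comment> \<open>By invariance under negation, the coefficient of the square at 0 is the sum of
    the squares of all coefficients.\<close>
  define d where "d = convolution c c"
  show thesis
  proof (rule that[of d])
    show "finite (fun_support d)" unfolding d_def by (intro finite_convolution_support c)
    have "d 0 = (\<Sum>m\<in>fun_support c. c m * c m)"
      unfolding d_def convolution_def by (simp add: reflect_invariant_uminus[of c] inv')
    also have "\<dots> > 0" using c by (intro sum_pos) (auto simp: zero_less_mult_iff)
    finally show "d 0 \<noteq> 0" by simp
    show "evaluation \<mu> d = 0"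
      unfolding d_def using evaluation_convolution[of c c \<mu>, OF c(1) c(1) \<mu>] c(3) by simp
    have "convolution c c \<circ> reflect k = convolution c c" for k
      using convolution_automorphism[of "reflect k" c c] by (simp add: inv reflect_diff)
    then show "d (reflect k n) = d n" for k n by (simp add: d_def fun_eq_iff)
  qed
qed

subsection \<open>Integer combinations of square roots\<close>

text \<open>After expanding the power, a monomial odd in some coordinate cancels in the sum under
  the reflection of that coordinate, and one even in all coordinates contributes a product of the
  integers \<open>s i ^ 2\<close>.\<close>

lemma symmetric_power_sum_in_Ints:
  fixes s :: "'n::finite \<Rightarrow> 'a::comm_ring_1" and b :: "int ^ 'n \<Rightarrow> int"
  assumes "finite S" and S: "\<And>k n. n \<in> S \<Longrightarrow> reflect k n \<in> S"
    and b: "\<And>k n. b (reflect k n) = b n" and s: "\<And>i. s i ^ 2 \<in> \<int>"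
  shows "(\<Sum>n\<in>S. of_int (b n) * (\<Sum>i\<in>UNIV. of_int (n $ i) * s i) ^ m) \<in> \<int>"
proof -
  \<comment> \<open>A word \<open>w\<close> of length \<open>m\<close> picks one summand from each
    factor; \<open>mono w n\<close> is the resulting product of coordinates and
    \<open>mult w k\<close> counts how often \<open>k\<close> is picked.\<close>
  define W where "W = ({..<m} \<rightarrow>\<^sub>E (UNIV :: 'n set))"
  define mono where "mono = (\<lambda>w (n :: int ^ 'n). \<Prod>t<m. n $ w t)"
  define mult where "mult = (\<lambda>w (k::'n). card {t\<in>{..<m}. w t = k})"
  have "(\<Sum>i\<in>UNIV. of_int (n $ i) * s i) ^ m = (\<Sum>w\<in>W. of_int (mono w n) * (\<Prod>t<m. s (w t)))" for n
    using prod_sum_PiE[of "{..<m}" "\<lambda>_. UNIV" "\<lambda>_ i. of_int (n $ i) * s i"]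
    by (simp add: W_def mono_def prod.distrib)
  then have "(\<Sum>n\<in>S. of_int (b n) * (\<Sum>i\<in>UNIV. of_int (n $ i) * s i) ^ m) =
      (\<Sum>w\<in>W. of_int (\<Sum>n\<in>S. b n * mono w n) * (\<Prod>t<m. s (w t)))"
    by (simp add: sum_distrib_left sum_distrib_right mult_ac) (subst sum.swap, simp)
  also have "\<dots> \<in> \<int>"
  proof (rule Ints_sum)
    fix w
    show "of_int (\<Sum>n\<in>S. b n * mono w n) * (\<Prod>t<m. s (w t)) \<in> \<int>"
    proof (cases "\<forall>k. even (mult w k)")
      case True
      have "(\<Prod>t<m. s (w t)) = (\<Prod>k\<in>UNIV. \<Prod>t | t \<in> {..<m} \<and> w t = k. s (w t))"
        by (rule prod.group[symmetric]) auto
      also have "\<dots> = (\<Prod>k\<in>UNIV. s k ^ mult w k)"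
        by (intro prod.cong) (simp_all add: mult_def)
      also have "\<dots> \<in> \<int>"
      proof (rule Ints_prod)
        fix k
        obtain j where "mult w k = 2 * j" using True by blast
        then show "s k ^ mult w k \<in> \<int>" using s[of k] by (simp add: power_mult Ints_power)
      qed
      finally show ?thesis by (intro Ints_mult) auto
    next
      case False
      then obtain k where k: "odd (mult w k)" by blast
      have "mono w (reflect k n) = - mono w n" for n
      proof -
        have "mono w (reflect k n) = (\<Prod>t<m. (if w t = k then - 1 else 1) * n $ w t)"
          unfolding mono_def reflect_def by (intro prod.cong) auto
        also have "\<dots> = (\<Prod>t<m. if w t = k then - 1 else 1) * mono w n"
          by (simp add: prod.distrib mono_def)
        also have "(\<Prod>t<m. if w t = k then - 1 else (1::int)) = (- 1) ^ mult w k"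
          by (simp add: prod.If_cases mult_def Int_def)
        finally show ?thesis using k by simp
      qed
      then have "(\<Sum>n\<in>S. b n * mono w n) = (\<Sum>n\<in>S. - (b n * mono w n))"
        using S by (intro sum.reindex_bij_witness[of _ "reflect k" "reflect k"]) (auto simp: b)
      then have "(\<Sum>n\<in>S. b n * mono w n) = 0" by (simp add: sum_negf)
      then show ?thesis by simp
    qed
  qed
  finally show ?thesis .
qed

text \<open>The two values are conjugate under \<open>s \<mapsto> - s\<close>. The induction is
  Horner's scheme, with witnesses read off from
  \<open>(x - c s)(u + s v) = (x u - c d v) + s (x v - c u)\<close>.\<close>

lemma ieval_quadratic_split:
  fixes s :: "'a::comm_ring_1"
  assumes "s ^ 2 = of_int d"
  shows "\<exists>u v. \<forall>x. ieval q (x - of_int c * s) = ieval u x + s * ieval v x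
                 \<and> ieval q (x + of_int c * s) = ieval u x - s * ieval v x"
proof (induction q)
  case 0
  show ?case by (rule exI[of _ 0], rule exI[of _ 0]) simp
next
  case (pCons a q)
  then obtain u v where uv: "\<And>x. ieval q (x - of_int c * s) = ieval u x + s * ieval v x"
    "\<And>x. ieval q (x + of_int c * s) = ieval u x - s * ieval v x" by blast
  have ss: "s * s = of_int d" "s * (s * y) = of_int d * y" for y
    using assms by (simp_all add: power2_eq_square mult.assoc[symmetric])
  show ?case
    by (rule exI[of _ "pCons a u - smult (c * d) v"], rule exI[of _ "pCons 0 v - smult c u"])
       (simp only: ieval_pCons ieval_diff ieval_smult uv, simp add: algebra_simps ss)
qed

lemma finite_ieval_roots:
  assumes "q \<noteq> 0"
  shows "finite {z::'a::{idom,ring_char_0}. ieval q z = 0}"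
  unfolding ieval_def using assms by (intro poly_roots_finite) (simp add: map_poly_eq_0_iff)

text \<open>A polynomial for a partial sum is passed on to the next by the norm
  \<open>q(x - y) q(x + y) = u^2 - d v^2\<close>, which has integer coefficients and vanishes when
  \<open>x - y\<close> is the old root.\<close>

lemma ieval_root_sum_quadratic:
  fixes s :: "'n \<Rightarrow> 'a::{idom,ring_char_0}"
  assumes "finite I" "\<And>i. s i ^ 2 \<in> \<int>"
  shows "\<exists>q. q \<noteq> 0 \<and> ieval q (\<Sum>i\<in>I. of_int (n i) * s i) = 0"
  using \<open>finite I\<close>
proof (induction I)
  case empty
  show ?case by (rule exI[of _ "[:0, 1:]"]) simp
next
  case (insert i I)
  then obtain q where q: "q \<noteq> 0" "ieval q (\<Sum>i\<in>I. of_int (n i) * s i) = 0" by blast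
  define y where "y = of_int (n i) * s i"
  obtain d where d: "s i ^ 2 = of_int d" using assms(2)[of i] by (auto elim: Ints_cases)
  obtain u v where uv: "\<And>x. ieval q (x - y) = ieval u x + s i * ieval v x"
    "\<And>x. ieval q (x + y) = ieval u x - s i * ieval v x"
    using ieval_quadratic_split[of "s i" d q "n i", OF d] unfolding y_def by blast
  define q' where "q' = u * u - smult d (v * v)"
  have q': "ieval q' x = ieval q (x - y) * ieval q (x + y)" for x
    unfolding uv q'_def by (simp add: d[symmetric] power2_eq_square algebra_simps)
  \<comment> \<open>Otherwise every element of the infinite domain would be a root of
    \<open>q\<close> after a shift by \<open>y\<close> or \<open>- y\<close>.\<close>
  have "q' \<noteq> 0"
  proof
    assume "q' = 0"
    then have "UNIV = (\<lambda>x. x - y) -` {z. ieval q z = 0} \<union> (\<lambda>x. x + y) -` {z. ieval q z = 0}"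
      using q' by auto
    moreover have "finite \<dots>"
      using finite_ieval_roots[OF q(1), where 'a = 'a] by (intro finite_UnI finite_vimageI) (auto simp: inj_def)
    ultimately show False using infinite_UNIV_char_0[where 'a = 'a] by simp
  qed
  moreover have "ieval q' (\<Sum>i\<in>insert i I. of_int (n i) * s i) = 0"
    using insert.hyps q(2) by (simp add: q' y_def[symmetric])
  ultimately show ?case by blast
qed

text \<open>Dividing out the full power of \<open>X\<close> removes the root 0 and keeps the root
  \<open>\<alpha>\<close>.\<close>

lemma ieval_root_nonzero_at_0:
  fixes \<alpha> :: "'a::idom"
  assumes "q \<noteq> 0" "ieval q \<alpha> = 0" "\<alpha> \<noteq> 0"
  shows "\<exists>r. poly r 0 \<noteq> 0 \<and> ieval r \<alpha> = 0"
proof -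
  obtain r where r: "q = [:- 0, 1:] ^ order 0 q * r" "\<not> [:- 0, 1:] dvd r"
    using order_decomp[OF assms(1), of 0] by blast
  have "ieval ([:- 0, 1:] ^ order 0 q * r) \<alpha> = 0" using r(1) assms(2) by simp
  then have "ieval r \<alpha> = 0" using assms(3) by simp
  with r(2) show ?thesis by (metis poly_eq_0_iff_dvd)
qed

text \<open>A nontrivial relation, once symmetrized, contradicts
  \<open>hermite_lindemann_symmetric\<close>, where \<open>g\<close> is the product of annihilating
  polynomials of the nonzero exponents.\<close>

theorem exp_int_combinations_sqrt_primes_independent:
  fixes r :: "'n::finite \<Rightarrow> nat" and c :: "int ^ 'n \<Rightarrow> int"
  assumes r: "inj r" "\<And>i. prime (r i)" and fin: "finite (fun_support c)"
    and zero: "evaluation (\<lambda>n. exp (\<Sum>i\<in>UNIV. of_int (n $ i) * (2 * \<i> * of_real (sqrt (r i))))) c = 0"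
  shows "fun_support c = {}"
proof (rule ccontr)
  assume ne: "fun_support c \<noteq> {}"
  define s where "s = (\<lambda>i. 2 * \<i> * complex_of_real (sqrt (r i)))"
  define \<alpha> where "\<alpha> = (\<lambda>n :: int ^ 'n. \<Sum>i\<in>UNIV. of_int (n $ i) * s i)"
  \<comment> \<open>This map serves twice: it embeds the exponent vectors in an ordered group, and
    its trivial kernel gives \<open>\<alpha> n \<noteq> 0\<close> for
    \<open>n \<noteq> 0\<close>.\<close>
  define ord where "ord = (\<lambda>n :: int ^ 'n. \<Sum>i\<in>UNIV. of_int (n $ i) * sqrt (r i))"
  have ord0: "n = 0" if "ord n = 0" for n
    using sum_sqrt_primes_eq_0[of UNIV r "\<lambda>i. n $ i"] r that by (auto simp: ord_def vec_eq_iff)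
  have add: "ord (m + k) = ord m + ord k" for m k
    by (simp add: ord_def algebra_simps sum.distrib)
  have "inj ord"
  proof (rule injI)
    fix m k assume "ord m = ord k"
    moreover have "ord (m - k) + ord k = ord m" by (simp flip: add)
    ultimately show "m = k" using ord0[of "m - k"] by simp
  qed
  have \<alpha>: "\<alpha> n = 2 * \<i> * of_real (ord n)" for n
    by (simp add: \<alpha>_def ord_def s_def sum_distrib_left mult_ac)
  have "evaluation (\<lambda>n. exp (\<alpha> n)) c = 0" using zero unfolding \<alpha>_def s_def .
  moreover have "exp (\<alpha> (m + k)) = exp (\<alpha> m) * exp (\<alpha> k)" for m k
    by (simp add: \<alpha> add algebra_simps flip: exp_add)
  ultimately obtain b where b: "finite (fun_support b)" "b 0 \<noteq> 0"
    "evaluation (\<lambda>n. exp (\<alpha> n)) b = 0" "\<And>k n. b (reflect k n) = b n"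
    using symmetrize[of c "\<lambda>n. exp (\<alpha> n)" ord] fin ne add \<open>inj ord\<close> by blast
  define I where "I = fun_support b - {0}"
  have "finite I" using b(1) by (simp add: I_def)
  have s2: "s i ^ 2 \<in> \<int>" for i
  proof -
    have "s i ^ 2 = - 4 * (complex_of_real (sqrt (r i) ^ 2))"
      by (simp add: s_def power_mult_distrib flip: of_real_power)
    then have "s i ^ 2 = of_int (- 4 * int (r i))" by simp
    then show ?thesis by (metis Ints_of_int)
  qed
  have "\<exists>q. poly q 0 \<noteq> 0 \<and> ieval q (\<alpha> n) = 0" if "n \<in> I" for n
  proof -
    have "\<alpha> n \<noteq> 0" using that ord0[of n] by (auto simp: \<alpha> I_def)
    then show ?thesis
      using ieval_root_sum_quadratic[of UNIV s "\<lambda>i. n $ i"] s2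
      by (auto simp: \<alpha>_def intro: ieval_root_nonzero_at_0)
  qed
  then obtain q where q: "\<And>n. n \<in> I \<Longrightarrow> poly (q n) 0 \<noteq> 0" "\<And>n. n \<in> I \<Longrightarrow> ieval (q n) (\<alpha> n) = 0"
    by metis
  have "of_int (b 0) + (\<Sum>n\<in>I. of_int (b n) * exp (\<alpha> n)) \<noteq> 0"
  proof (rule hermite_lindemann_symmetric[OF \<open>finite I\<close> b(2), where g = "\<Prod>n\<in>I. q n"])
    show "(\<Sum>n\<in>I. of_int (b n) * \<alpha> n ^ m) \<in> \<int>" for m
      unfolding \<alpha>_def using \<open>finite I\<close> b(4) s2
      by (intro symmetric_power_sum_in_Ints) (auto simp: I_def)
    show "ieval (\<Prod>n\<in>I. q n) (\<alpha> n) = 0" if "n \<in> I" for n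
      using that q(2) \<open>finite I\<close> by auto
    show "poly (\<Prod>n\<in>I. q n) 0 \<noteq> 0"
      using q(1) \<open>finite I\<close> by (simp add: poly_prod)
  qed
  moreover have "evaluation (\<lambda>n. exp (\<alpha> n)) b = of_int (b 0) + (\<Sum>n\<in>I. of_int (b n) * exp (\<alpha> n))"
    unfolding evaluation_def I_def using b(1,2) by (subst sum.remove[of _ 0]) (auto simp: \<alpha>_def)
  ultimately show False using b(3) by simp
qed

subsection \<open>Integer point transforms\<close>

definition of_int_vec :: "int ^ 'n \<Rightarrow> real ^ 'n::finite" where
  "of_int_vec n = (\<chi> i. of_int (n $ i))"

lemma bij_of_int_vec: "bij_betw of_int_vec UNIV int_lattice"
proof (rule bij_betw_imageI)
  show "inj of_int_vec" by (auto simp: inj_def of_int_vec_def vec_eq_iff)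
  have "x \<in> range of_int_vec" if "x \<in> int_lattice" for x :: "real ^ 'n"
    using that by (intro image_eqI[of _ _ "\<chi> i. \<lfloor>x $ i\<rfloor>"]) (auto simp: int_lattice_def of_int_vec_def vec_eq_iff)
  then show "range of_int_vec = (int_lattice :: (real ^ 'n) set)"
    by (auto simp: int_lattice_def of_int_vec_def)
qed

lemma finite_bounded_Int_int_lattice:
  fixes S :: "(real ^ 'n::finite) set"
  assumes "bounded S"
  shows "finite (S \<inter> int_lattice)"
proof -
  obtain B where B: "\<And>x. x \<in> S \<Longrightarrow> norm x \<le> B" using assms by (auto simp: bounded_iff)
  define F where "F = {n :: int ^ 'n. \<forall>i. n $ i \<in> {- \<lceil>B\<rceil>..\<lceil>B\<rceil>}}"
  have "F \<subseteq> (\<lambda>f. \<chi> i. f i) ` (UNIV \<rightarrow>\<^sub>E {- \<lceil>B\<rceil>..\<lceil>B\<rceil>})"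
  proof
    fix n assume "n \<in> F"
    then show "n \<in> (\<lambda>f. \<chi> i. f i) ` (UNIV \<rightarrow>\<^sub>E {- \<lceil>B\<rceil>..\<lceil>B\<rceil>})"
      by (intro image_eqI[of _ _ "vec_nth n"]) (auto simp: F_def)
  qed
  then have "finite F" by (rule finite_subset) (intro finite_imageI finite_PiE, simp_all)
  moreover have "S \<inter> int_lattice \<subseteq> of_int_vec ` F"
  proof
    fix x assume x: "x \<in> S \<inter> int_lattice"
    then obtain n where n: "x = of_int_vec n"
      using bij_betw_imp_surj_on[OF bij_of_int_vec] by blast
    have "- \<lceil>B\<rceil> \<le> n $ i \<and> n $ i \<le> \<lceil>B\<rceil>" for i
      using component_le_norm_cart[of x i] B[of x] x n unfolding of_int_vec_def by (simp; linarith)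
    then show "x \<in> of_int_vec ` F" using n by (auto simp: F_def)
  qed
  ultimately show ?thesis by (rule finite_surj)
qed

text \<open>By Minkowski's theorem a polytope is the convex hull of its extreme points, and these
  are lattice points here.\<close>

lemma integer_polytope_eq_hull:
  assumes "integer_polytope P"
  shows "P = convex hull (P \<inter> int_lattice)"
proof
  have P: "compact P" "convex P"
    using assms by (auto simp: integer_polytope_def polytope_imp_compact polytope_imp_convex)
  have "{x. x extreme_point_of P} \<subseteq> P \<inter> int_lattice"
    using assms by (auto simp: integer_polytope_def int_lattice_def extreme_point_of_def)
  then show "P \<subseteq> convex hull (P \<inter> int_lattice)"
    using Krein_Milman_Minkowski[OF P] hull_mono by metis
  show "convex hull (P \<inter> int_lattice) \<subseteq> P"
    using P(2) by (simp add: hull_minimal)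
qed

text \<open>Equal transforms give a vanishing combination of exponentials whose coefficients are the
  difference of the two indicator functions.\<close>

lemma integer_point_transform_xi_star_eq_iff:
  fixes e :: "'n::finite \<Rightarrow> nat" and A B :: "(real ^ 'n) set"
  assumes "inj e" "finite A" "A \<subseteq> int_lattice" "finite B" "B \<subseteq> int_lattice"
  shows "integer_point_transform A (xi_star e) = integer_point_transform B (xi_star e) \<longleftrightarrow> A = B"
proof
  assume eq: "integer_point_transform A (xi_star e) = integer_point_transform B (xi_star e)"
  define r where "r = (\<lambda>i. nth_prime (e i))"
  have inf: "infinite {p::nat. prime p}" by (rule primes_infinite)
  have r: "inj r" "prime (r i)" for i
    using inj_compose[OF inj_enumerate[OF inf] \<open>inj e\<close>] enumerate_in_set[OF inf]
    by (auto simp: r_def nth_prime_def o_def)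
  define E where "E = (\<lambda>n. exp (\<Sum>i\<in>UNIV. of_int (n $ i) * (2 * \<i> * complex_of_real (sqrt (r i)))))"
  \<comment> \<open>The factor \<open>1 / pi\<close> in \<open>xi_star\<close> cancels the
    \<open>pi\<close> of the transform.\<close>
  have E: "exp (2 * complex_of_real pi * \<i> * complex_of_real (of_int_vec n \<bullet> xi_star e)) = E n" for n
    unfolding E_def
    by (simp add: xi_star_def of_int_vec_def inner_vec_def r_def sum_distrib_left mult_ac)
  have transform: "integer_point_transform S (xi_star e) = (\<Sum>n\<in>of_int_vec -` S. E n)"
    and fin: "finite (of_int_vec -` S)"
    if "S \<subseteq> int_lattice" "finite S" for S :: "(real ^ 'n) set"
  proof -
    have S: "of_int_vec ` (of_int_vec -` S) = S"
      using that bij_betw_imp_surj_on[OF bij_of_int_vec] by (metis image_vimage_eq inf.absorb1)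
    have inj: "inj_on of_int_vec X" for X :: "(int ^ 'n) set"
      using bij_betw_imp_inj_on[OF bij_of_int_vec] by (rule inj_on_subset) simp
    show "finite (of_int_vec -` S)" using that(2) inj by (rule finite_vimageI)
    show "integer_point_transform S (xi_star e) = (\<Sum>n\<in>of_int_vec -` S. E n)"
      unfolding integer_point_transform_def
      by (subst S[symmetric], subst sum.reindex[OF inj]) (simp add: E)
  qed
  define A' where "A' = of_int_vec -` A"
  define B' where "B' = of_int_vec -` B"
  have fin': "finite A'" "finite B'" using fin assms by (auto simp: A'_def B'_def)
  define c where "c = (\<lambda>n. of_bool (n \<in> A') - of_bool (n \<in> B') :: int)"
  have supp: "fun_support c \<subseteq> A' \<union> B'" by (auto simp: c_def)
  have "evaluation E c = (\<Sum>n\<in>A' \<union> B'. of_int (c n) * E n)"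
    using fin' supp by (intro evaluation_superset) auto
  also have "\<dots> = (\<Sum>n\<in>A' \<union> B'. if n \<in> A' then E n else 0) - (\<Sum>n\<in>A' \<union> B'. if n \<in> B' then E n else 0)"
    by (simp add: c_def sum_subtractf[symmetric] del: sum_subtractf) (intro sum.cong, auto)
  also have "\<dots> = (\<Sum>n\<in>A'. E n) - (\<Sum>n\<in>B'. E n)"
    using fin' by (simp add: sum.inter_restrict[symmetric] Int_absorb1)
  also have "\<dots> = 0" using eq transform assms by (simp add: A'_def B'_def)
  finally have "fun_support c = {}"
    unfolding E_def using r finite_subset[OF supp] fin'
    by (intro exp_int_combinations_sqrt_primes_independent) auto
  then have "n \<in> A' \<longleftrightarrow> n \<in> B'" for n
    by (auto simp: c_def of_bool_def split: if_splits)
  then have "A' = B'" by blast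
  then show "A = B"
    unfolding A'_def B'_def using assms bij_betw_imp_surj_on[OF bij_of_int_vec]
    by (metis image_vimage_eq inf.absorb1)
qed simp

lemma polytope_transform_xi_star_eq_iff:
  fixes e :: "'n::finite \<Rightarrow> nat" and P Q :: "(real ^ 'n) set"
  assumes "inj e" "integer_polytope P" "integer_polytope Q"
  shows "polytope_transform P (xi_star e) = polytope_transform Q (xi_star e) \<longleftrightarrow> P = Q"
proof -
  have "bounded P" "bounded Q"
    using assms by (auto simp: integer_polytope_def polytope_imp_bounded)
  then have "polytope_transform P (xi_star e) = polytope_transform Q (xi_star e) \<longleftrightarrow>
      P \<inter> int_lattice = Q \<inter> int_lattice"
    unfolding polytope_transform_def
    by (intro integer_point_transform_xi_star_eq_iff assms finite_bounded_Int_int_lattice) auto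
  also have "\<dots> \<longleftrightarrow> P = Q"
    using assms integer_polytope_eq_hull by metis
  finally show ?thesis .
qed

theorem theorem1p1:
  fixes e :: "'n::finite \<Rightarrow> nat"
  assumes "bij_betw e UNIV {..<CARD('n)}"
  shows "(\<forall>A B :: (real ^ 'n) set.
            finite A \<longrightarrow> A \<subseteq> int_lattice \<longrightarrow> finite B \<longrightarrow> B \<subseteq> int_lattice \<longrightarrow>
            (integer_point_transform A (xi_star e) = integer_point_transform B (xi_star e)
              \<longleftrightarrow> A = B))
       \<and> (\<forall>P Q :: (real ^ 'n) set.
            integer_polytope P \<longrightarrow> integer_polytope Q \<longrightarrow>
            (polytope_transform P (xi_star e) = polytope_transform Q (xi_star e)
              \<longleftrightarrow> P = Q))
       \<and> (\<forall>(P :: (real ^ 'n) set) (Q :: (real ^ 'n) set) (k :: nat).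
            rational_polytope P \<longrightarrow> rational_polytope Q \<longrightarrow> k > 0 \<longrightarrow>
            integer_polytope ((*\<^sub>R) (real k) ` P) \<longrightarrow> integer_polytope ((*\<^sub>R) (real k) ` Q) \<longrightarrow>
            (polytope_transform ((*\<^sub>R) (real k) ` P) (xi_star e)
               = polytope_transform ((*\<^sub>R) (real k) ` Q) (xi_star e)
              \<longleftrightarrow> P = Q))"
proof -
  have "inj e" using assms by (rule bij_betw_imp_inj_on)
  \<comment> \<open>Part (3) is part (2) for the dilated polytopes, since a dilation by
    \<open>k > 0\<close> can be undone.\<close>
  have "inj ((*\<^sub>R) (real k) :: real ^ 'n \<Rightarrow> _)" if "k > 0" for k
    using that by (simp add: inj_def)
  then have "((*\<^sub>R) (real k) ` P = (*\<^sub>R) (real k) ` Q) \<longleftrightarrow> P = Q"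
    if "k > 0" for k and P Q :: "(real ^ 'n) set"
    using that by (simp add: inj_image_eq_iff)
  then show ?thesis
    using \<open>inj e\<close> by (simp add: integer_point_transform_xi_star_eq_iff polytope_transform_xi_star_eq_iff)
qed

end
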